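(* Let $\Omega$ be a domain in $\mathbb{R}^n$ with $n>2$, and let $f:\mathbb{R}\to\mathbb{R}$ be a function such that for every $u\in H^1(\Omega)$ the composition $f\circ u$ belongs to $C^0(\bar\Omega)$ (i.e. has a continuous representative). Then $f$ is a constant function.
   Context: $H^1(\Omega)$ is the Sobolev space of $L^2(\Omega)$ functions with weak first derivatives in $L^2(\Omega)$; $C^0(\bar\Omega)$ is the space of continuous real-valued functions on $\bar\Omega$. A function $f:\mathbb{R}\to\mathbb{R}$ is regarded as acting on functions via composition $u\mapsto f\circ u$. *)

theory Defs
  imports "HOL-Analysis.Analysis"
begin

definition partial_deriv :: "'n::finite \<Rightarrow> (real^'n \<Rightarrow> real) \<Rightarrow> real^'n \<Rightarrow> real" where
  "partial_deriv i \<phi> x = deriv (\<lambda>t. \<phi> (x + t *\<^sub>R axis i 1)) 0"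

definition iter_partial :: "'n::finite list \<Rightarrow> (real^'n \<Rightarrow> real) \<Rightarrow> real^'n \<Rightarrow> real" where
  "iter_partial is \<phi> = foldr partial_deriv is \<phi>"

definition smooth_fun :: "(real^'n::finite \<Rightarrow> real) \<Rightarrow> bool" where
  "smooth_fun \<phi> \<longleftrightarrow>
     (\<forall>is. continuous_on UNIV (iter_partial is \<phi>) \<and>
       (\<forall>i x. (\<lambda>t. iter_partial is \<phi> (x + t *\<^sub>R axis i 1)) differentiable (at 0)))"

definition test_fun :: "(real^'n::finite) set \<Rightarrow> (real^'n \<Rightarrow> real) \<Rightarrow> bool" where
  "test_fun \<Omega> \<phi> \<longleftrightarrow> smooth_fun \<phi> \<and>
     compact (closure {x. \<phi> x \<noteq> 0}) \<and> closure {x. \<phi> x \<noteq> 0} \<subseteq> \<Omega>"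

definition L2_on :: "(real^'n::finite) set \<Rightarrow> (real^'n \<Rightarrow> real) \<Rightarrow> bool" where
  "L2_on \<Omega> u \<longleftrightarrow> u \<in> borel_measurable (lebesgue_on \<Omega>) \<and>
     integrable (lebesgue_on \<Omega>) (\<lambda>x. (u x)^2)"

definition H1 :: "(real^'n::finite) set \<Rightarrow> (real^'n \<Rightarrow> real) set" where
  "H1 \<Omega> = {u. L2_on \<Omega> u \<and>
     (\<exists>g :: 'n \<Rightarrow> real^'n \<Rightarrow> real. \<forall>i. L2_on \<Omega> (g i) \<and>
        (\<forall>\<phi>. test_fun \<Omega> \<phi> \<longrightarrow>
           (LINT x|lebesgue_on \<Omega>. u x * partial_deriv i \<phi> x) =
           - (LINT x|lebesgue_on \<Omega>. g i x * \<phi> x)))}"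

definition has_C0_closure_rep :: "(real^'n::finite) set \<Rightarrow> (real^'n \<Rightarrow> real) \<Rightarrow> bool" where
  "has_C0_closure_rep \<Omega> w \<longleftrightarrow>
     (\<exists>v. continuous_on (closure \<Omega>) v \<and> (AE x in lebesgue_on \<Omega>. w x = v x))"

end

theory Submission
  imports Defs
begin

text \<open>Fix \<open>x0\<close> in the domain and a value \<open>a\<close>. There is a compactly supported \<open>u\<close> in \<open>H1\<close> which
  equals \<open>a\<close> on spherical shells shrinking to \<open>x0\<close> and \<open>0\<close> on shells in between. A continuous
  representative of \<open>f \<circ> u\<close> must therefore take both values \<open>f a\<close> and \<open>f 0\<close> at \<open>x0\<close>.\<close>

section \<open>A C^1 cutoff with a plateau\<close>

text \<open>The cutoff will be composed with rescaled squared distances. Only first derivatives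
  enter \<open>H1\<close>, so a C^1 piecewise polynomial suffices.\<close>

lemma C1_plateau_function:
  obtains \<theta> \<theta>' :: "real \<Rightarrow> real" and C where
    "\<And>s. (\<theta> has_real_derivative \<theta>' s) (at s)"
    "continuous_on UNIV \<theta>'"
    "\<And>s. s \<notin> {1/2<..<1} \<Longrightarrow> \<theta> s = 0"
    "\<And>s. s \<notin> {1/2<..<1} \<Longrightarrow> \<theta>' s = 0"
    "\<And>s. s \<in> {5/8..7/8} \<Longrightarrow> \<theta> s = 1"
    "\<And>s. \<bar>\<theta> s\<bar> \<le> C" "\<And>s. \<bar>\<theta>' s\<bar> \<le> C"
proof -
  define p :: "real \<Rightarrow> real" where "p t = (max 0 t)\<^sup>2" for t
  \<comment> \<open>The parabola is positive exactly on (1/2, 1). The factor 32 lifts it to 3/2 at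
    5/8 and 7/8, above the level 1 required for the plateau.\<close>
  define q :: "real \<Rightarrow> real" where "q s = 32 * (s - 1/2) * (1 - s)" for s
  have p: "(p has_real_derivative 2 * max 0 t) (at t)" for t
  proof -
    consider "t < 0" | "t > 0" | "t = 0" by linarith
    then show ?thesis
    proof cases
      case 1
      have "((\<lambda>t. 0) has_real_derivative 2 * max 0 t) (at t)"
        using 1 by auto
      then show ?thesis
        by (rule has_field_derivative_transform_within_open[where S = "{..<0}"])
          (use 1 in \<open>auto simp: p_def\<close>)
    next
      case 2
      have "((\<lambda>t. t\<^sup>2) has_real_derivative 2 * max 0 t) (at t)"
        using 2 by (auto intro!: derivative_eq_intros)
      then show ?thesis
        by (rule has_field_derivative_transform_within_open[where S = "{0<..}"])
          (use 2 in \<open>auto simp: p_def\<close>)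
    next
      case 3
      have "((\<lambda>h. p h / h) \<longlongrightarrow> 0) (at 0)"
      proof (rule Lim_null_comparison)
        show "\<forall>\<^sub>F h in at 0. norm (p h / h) \<le> \<bar>h\<bar>"
          by (intro always_eventually allI) (auto simp: p_def max_def power2_eq_square)
        show "((\<lambda>h. \<bar>h\<bar>) \<longlongrightarrow> 0) (at (0::real))"
          by (rule tendsto_eq_intros | simp)+
      qed
      then show ?thesis using 3 by (simp add: DERIV_def p_def)
    qed
  qed
  have q: "(q has_real_derivative 32 * (3/2 - 2 * s)) (at s)" for s
    unfolding q_def by (auto intro!: derivative_eq_intros simp: field_simps)
  \<comment> \<open>The inner \<open>p\<close> erases negative values of \<open>q\<close>, giving
    the value 0; the outer \<open>p\<close> erases \<open>1 - p (q s)\<close> as soon as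
    \<open>q s\<close> reaches 1, giving the value 1. Since \<open>p\<close> is C^1, so is the
    composition.\<close>
  define \<theta> where "\<theta> s = 1 - p (1 - p (q s))" for s
  define \<theta>' where "\<theta>' s = 2 * max 0 (1 - p (q s)) * (2 * max 0 (q s) * (32 * (3/2 - 2 * s)))" for s
  have D: "(\<theta> has_real_derivative \<theta>' s) (at s)" for s
    unfolding \<theta>_def \<theta>'_def
    by (auto intro!: derivative_eq_intros DERIV_chain2[OF p] p q simp: algebra_simps)
  have cont: "continuous_on UNIV \<theta>'"
    unfolding \<theta>'_def p_def q_def by (intro continuous_intros)
  have q_neg: "q s \<le> 0" if "s \<notin> {1/2<..<1}" for s
  proof -
    have "(s - 1/2) * (1 - s) \<le> 0"
      using that by (auto simp: mult_le_0_iff)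
    then have "32 * ((s - 1/2) * (1 - s)) \<le> 0" by linarith
    then show ?thesis by (simp only: q_def mult.assoc)
  qed
  have zero: "\<theta> s = 0" "\<theta>' s = 0" if "s \<notin> {1/2<..<1}" for s
    using q_neg[OF that] by (auto simp: \<theta>_def \<theta>'_def p_def)
  have one: "\<theta> s = 1" if "s \<in> {5/8..7/8}" for s
  proof -
    have "q s = 1 + 32 * ((s - 5/8) * (7/8 - s)) + 1/2"
      by (simp add: q_def field_simps)
    moreover have "0 \<le> (s - 5/8) * (7/8 - s)" using that by auto
    ultimately have "1 \<le> q s" by linarith
    then have "1 \<le> p (q s)" by (simp add: p_def)
    then show ?thesis by (simp add: \<theta>_def p_def)
  qed
  have bdd: "\<exists>C. \<forall>s. \<bar>g s\<bar> \<le> C"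
    if "continuous_on UNIV g" "\<And>s. s \<notin> {1/2<..<1} \<Longrightarrow> g s = 0" for g :: "real \<Rightarrow> real"
  proof -
    have "compact (g ` {1/2..1})"
      using that(1) by (intro compact_continuous_image) (auto intro: continuous_on_subset)
    then obtain C where C: "\<forall>y\<in>g ` {1/2..1}. \<bar>y\<bar> \<le> C"
      by (auto dest!: compact_imp_bounded simp: bounded_iff)
    have "\<bar>g s\<bar> \<le> max C 0" for s
      using C that(2)[of s] by (cases "s \<in> {1/2<..<1}") (auto simp: le_max_iff_disj)
    then show ?thesis by blast
  qed
  have "continuous_on UNIV \<theta>"
    using D by (meson DERIV_isCont continuous_at_imp_continuous_on)
  from bdd[OF this zero(1)] bdd[OF cont zero(2)]
  obtain A B where "\<And>s. \<bar>\<theta> s\<bar> \<le> A" "\<And>s. \<bar>\<theta>' s\<bar> \<le> B" by blast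
  then have "\<bar>\<theta> s\<bar> \<le> max A B" "\<bar>\<theta>' s\<bar> \<le> max A B" for s
    by (simp_all add: le_max_iff_disj)
  with D cont zero one show ?thesis by (intro that) blast+
qed

section \<open>Vanishing integrals of directional derivatives\<close>

text \<open>Translation invariance makes the integrals of all difference quotients vanish, and the
  quotients converge dominatedly to \<^term>\<open>D\<close>.\<close>

lemma integral_directional_derivative_eq_0:
  fixes w D :: "'a::euclidean_space \<Rightarrow> real"
  assumes w: "continuous_on UNIV w"
    and D: "continuous_on UNIV D"
    and deriv: "\<And>x. ((\<lambda>t. w (x + t *\<^sub>R e)) has_real_derivative D x) (at 0)"
    and bound: "\<And>x. \<bar>D x\<bar> \<le> M"
    and supp: "\<And>x. x \<notin> cball x0 r \<Longrightarrow> w x = 0"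
  shows "integral\<^sup>L lborel D = 0"
proof -
  \<comment> \<open>The hypothesis concerns t = 0 only, but at every base point; moving the base
    point gives the derivative along the whole line.\<close>
  have deriv': "((\<lambda>t. w (x + t *\<^sub>R e)) has_real_derivative D (x + s *\<^sub>R e)) (at s)" for x s
  proof -
    have "((\<lambda>t. w (x + s *\<^sub>R e + t *\<^sub>R e)) has_real_derivative D (x + s *\<^sub>R e)) (at 0)"
      by (rule deriv)
    then show ?thesis
      using DERIV_shift[of "\<lambda>t. w (x + t *\<^sub>R e)" "D (x + s *\<^sub>R e)" 0 s]
      by (simp add: algebra_simps)
  qed
  have M: "0 \<le> M" using bound[of x0] by linarith
  \<comment> \<open>The mean value theorem turns the bound on \<open>D\<close> into a Lipschitz
    bound along \<open>e\<close>, which controls all difference quotients at once.\<close>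
  have quotient_bound: "\<bar>w (x + t *\<^sub>R e) - w x\<bar> \<le> M * t" if t: "0 < t" for x t
  proof -
    obtain z where "w (x + t *\<^sub>R e) - w (x + 0 *\<^sub>R e) = (t - 0) * D (x + z *\<^sub>R e)"
      using MVT2[OF t, of "\<lambda>t. w (x + t *\<^sub>R e)" "\<lambda>s. D (x + s *\<^sub>R e)"] deriv' by blast
    then show ?thesis using t bound[of "x + z *\<^sub>R e"] by (simp add: abs_mult)
  qed
  have wb [measurable]: "w \<in> borel_measurable borel"
    and Db [measurable]: "D \<in> borel_measurable borel"
    using w D by (auto intro: borel_measurable_continuous_onI)
  have w_int: "integrable lborel w"
  proof -
    have "integrable lborel (\<lambda>x. indicator (cball x0 r) x *\<^sub>R w x)"
      by (intro borel_integrable_compact continuous_on_subset[OF w]) auto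
    also have "(\<lambda>x. indicator (cball x0 r) x *\<^sub>R w x) = w"
      using supp by (auto simp: fun_eq_iff indicator_def)
    finally show ?thesis .
  qed
  \<comment> \<open>Step lengths of at most 1 keep the supports of all quotients in the single ball
    of radius \<open>r + norm e\<close>, where the dominating function lives.\<close>
  define t where "t m = inverse (real (Suc m))" for m
  have t: "0 < t m" "t m \<le> 1" for m by (auto simp: t_def field_simps)
  have t0: "filterlim t (at 0) sequentially"
    using t(1) LIMSEQ_inverse_real_of_nat
    unfolding filterlim_at t_def[abs_def] by (auto simp: less_imp_neq[symmetric])
  define h where "h m x = (w (x + t m *\<^sub>R e) - w x) / t m" for m x
  have shift_int: "integrable lborel (\<lambda>x. w (x + c))" "(\<integral>x. w (x + c) \<partial>lborel) = integral\<^sup>L lborel w" for c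
  proof -
    have "integrable (distr lborel borel ((+) c)) w"
      using w_int by (simp add: lborel_distr_plus)
    then show "integrable lborel (\<lambda>x. w (x + c))"
      by (subst (asm) integrable_distr_eq) (auto simp: add.commute)
    have "integral\<^sup>L lborel w = integral\<^sup>L (distr lborel borel ((+) c)) w"
      by (simp add: lborel_distr_plus)
    also have "\<dots> = (\<integral>x. w (x + c) \<partial>lborel)"
      by (subst integral_distr) (auto simp: add.commute)
    finally show "(\<integral>x. w (x + c) \<partial>lborel) = integral\<^sup>L lborel w" ..
  qed
  have h0: "integral\<^sup>L lborel (h m) = 0" for m
    unfolding h_def using shift_int w_int by (simp add: Bochner_Integration.integral_diff)
  have "(\<lambda>m. integral\<^sup>L lborel (h m)) \<longlonglongrightarrow> integral\<^sup>L lborel D"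
  proof (rule integral_dominated_convergence[where w = "\<lambda>x. M * indicator (cball x0 (r + norm e)) x"])
    show "D \<in> borel_measurable lborel" "h m \<in> borel_measurable lborel" for m
      unfolding h_def by measurable
    show "integrable lborel (\<lambda>x. M * indicator (cball x0 (r + norm e)) x)"
      by (intro integrable_mult_right integrable_real_indicator)
        (use emeasure_lborel_cball_finite in auto)
    show "AE x in lborel. (\<lambda>m. h m x) \<longlonglongrightarrow> D x"
    proof (intro AE_I2)
      fix x
      have "((\<lambda>s. (w (x + s *\<^sub>R e) - w x) / s) \<longlongrightarrow> D x) (at 0)"
        using deriv[of x] by (simp add: DERIV_def)
      then show "(\<lambda>m. h m x) \<longlonglongrightarrow> D x"
        unfolding h_def by (rule filterlim_compose[OF _ t0])
    qed
    show "AE x in lborel. norm (h m x) \<le> M * indicator (cball x0 (r + norm e)) x" for m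
    proof (intro AE_I2)
      fix x
      show "norm (h m x) \<le> M * indicator (cball x0 (r + norm e)) x"
      proof (cases "x \<in> cball x0 (r + norm e)")
        case True
        then show ?thesis
          using quotient_bound[OF t(1), where x = x] t(1)[of m] by (simp add: h_def field_simps)
      next
        case False
        have "norm (x - x0) \<le> norm (x + t m *\<^sub>R e - x0) + norm (t m *\<^sub>R e)"
          using norm_triangle_ineq4[of "x + t m *\<^sub>R e - x0" "t m *\<^sub>R e"] by (simp add: algebra_simps)
        moreover have "norm (t m *\<^sub>R e) \<le> norm e"
          using t[of m] mult_right_mono[OF t(2)[of m] norm_ge_zero[of e]] by simp
        ultimately have "x + t m *\<^sub>R e \<notin> cball x0 r" 
          using False by (auto simp: dist_norm norm_minus_commute)
        moreover have "x \<notin> cball x0 r" using False norm_ge_zero[of e] by (auto simp del: norm_ge_zero)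
        ultimately show ?thesis using False by (simp add: h_def supp)
      qed
    qed
  qed
  then show ?thesis by (simp add: h0 LIMSEQ_const_iff)
qed

section \<open>Termwise integration of localized functions\<close>

text \<open>The L^1 norm of \<open>h k\<close> is at most \<open>M k\<close> times the volume of its
  ball, so summability of these products lets sum and integral be exchanged. This serves both the
  L^2 bounds and the weak derivative of the oscillating function.\<close>

lemma integral_sums_supported_cballs:
  fixes h :: "nat \<Rightarrow> 'a::euclidean_space \<Rightarrow> real"
  assumes \<Omega>: "open \<Omega>"
    and cont: "\<And>k. continuous_on UNIV (h k)"
    and bound: "\<And>k x. \<bar>h k x\<bar> \<le> M k"
    and supp: "\<And>k x. x \<notin> cball x0 (r k) \<Longrightarrow> h k x = 0"
    and summ: "summable (\<lambda>k. M k * measure lebesgue (cball x0 (r k)))"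
    and abs_summ: "\<And>x. summable (\<lambda>k. \<bar>h k x\<bar>)"
    and H: "\<And>x. (\<lambda>k. h k x) sums H x"
  shows "integrable (lebesgue_on \<Omega>) H"
    and "\<And>k. integrable (lebesgue_on \<Omega>) (h k)"
    and "(\<lambda>k. LINT x|lebesgue_on \<Omega>. h k x) sums (LINT x|lebesgue_on \<Omega>. H x)"
proof -
  have [simp]: "\<Omega> \<in> sets lebesgue" using \<Omega> by auto
  let ?b = "\<lambda>k x. M k * indicator (cball x0 (r k)) x :: real"
  have M: "0 \<le> M k" for k using bound[of k x0] by linarith
  have le: "\<bar>h k x\<bar> \<le> ?b k x" for k x
    using bound[of k x] supp[of x k] M[of k] by (auto simp: indicator_def)
  have bL: "integrable lebesgue (?b k)" for k
    by (intro integrable_mult_right integrable_real_indicator)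
      (use emeasure_lborel_cball_finite in auto)
  have b: "integrable (lebesgue_on \<Omega>) (?b k)" for k
    by (subst integrable_restrict_space) (use integrable_mult_indicator[OF _ bL] in auto)
  have "h k \<in> borel_measurable lebesgue" for k
    using cont by (intro measurable_completion) (auto intro: borel_measurable_continuous_onI)
  then have meas: "h k \<in> borel_measurable (lebesgue_on \<Omega>)" for k
    by (rule measurable_restrict_space1)
  have h: "integrable (lebesgue_on \<Omega>) (h k)" for k
    by (rule Bochner_Integration.integrable_bound[OF b[of k] meas])
      (use le in \<open>auto intro!: AE_I2 intro: order_trans[OF _ abs_ge_self]\<close>)
  then show "\<And>k. integrable (lebesgue_on \<Omega>) (h k)" .
  have "(LINT x|lebesgue_on \<Omega>. \<bar>h k x\<bar>) \<le> M k * measure lebesgue (cball x0 (r k))" for k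
  proof -
    have "(LINT x|lebesgue_on \<Omega>. \<bar>h k x\<bar>) \<le> (LINT x|lebesgue_on \<Omega>. ?b k x)"
      using le h b by (intro integral_mono) auto
    also have "\<dots> = (LINT x|lebesgue. indicator \<Omega> x *\<^sub>R ?b k x)"
      by (intro integral_restrict_space) auto
    also have "\<dots> \<le> (LINT x|lebesgue. ?b k x)"
    proof (rule integral_mono[OF integrable_mult_indicator[OF _ bL] bL])
      show "indicator \<Omega> x *\<^sub>R ?b k x \<le> ?b k x" for x
        using M[of k] by (simp add: indicator_def)
    qed simp
    also have "\<dots> = M k * measure lebesgue (cball x0 (r k))"
      by simp
    finally show ?thesis .
  qed
  then have "summable (\<lambda>k. LINT x|lebesgue_on \<Omega>. \<bar>h k x\<bar>)"
    by (intro summable_comparison_test'[OF summ]) auto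
  note * = this
  have H': "H = (\<lambda>x. \<Sum>k. h k x)" using H by (auto simp: sums_iff)
  show "integrable (lebesgue_on \<Omega>) H"
    unfolding H' by (intro integrable_suminf) (use h * abs_summ in auto)
  show "(\<lambda>k. LINT x|lebesgue_on \<Omega>. h k x) sums (LINT x|lebesgue_on \<Omega>. H x)"
    unfolding H' by (intro sums_integral) (use h * abs_summ in auto)
qed

section \<open>Continuous representatives and shells\<close>

text \<open>If \<open>v x0\<close> differed from \<open>c\<close>, then \<open>v\<close> would avoid
  \<open>c\<close> on a whole ball around \<open>x0\<close>. A nonempty open \<open>S\<close> in
  that ball would then consist of points where \<open>f\<close> and \<open>v\<close> disagree, yet
  such a set has positive measure.\<close>

lemma continuous_value_at_accumulation:
  fixes \<Omega> :: "'a::euclidean_space set" and f v :: "'a \<Rightarrow> real"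
  assumes v: "continuous_on (closure \<Omega>) v" and \<Omega>: "open \<Omega>" "x0 \<in> \<Omega>"
    and ae: "AE x in lebesgue_on \<Omega>. f x = v x"
    and S: "\<And>d. d > 0 \<Longrightarrow> \<exists>S. open S \<and> S \<noteq> {} \<and> S \<subseteq> \<Omega> \<inter> ball x0 d \<and> (\<forall>x\<in>S. f x = c)"
  shows "v x0 = c"
proof (rule ccontr)
  assume "v x0 \<noteq> c"
  moreover have "isCont v x0"
    using v \<Omega> by (metis closure_subset continuous_on_eq_continuous_at continuous_on_subset)
  ultimately obtain d where d: "d > 0" "\<And>y. dist x0 y < d \<Longrightarrow> v y \<noteq> c"
    using continuous_at_avoid[of x0 v c] by auto
  obtain S where S: "open S" "S \<noteq> {}" "S \<subseteq> \<Omega> \<inter> ball x0 d" "\<forall>x\<in>S. f x = c"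
    using S[OF d(1)] by blast
  have "AE x in lebesgue. x \<in> \<Omega> \<longrightarrow> f x = v x"
    using ae \<Omega> by (subst (asm) AE_restrict_space_iff) auto
  then have "AE x in lebesgue. x \<notin> S"
    by eventually_elim (use S d in force)
  then have "S \<in> null_sets lebesgue"
    using S(1) by (subst (asm) AE_iff_null_sets[symmetric]) auto
  then show False
    using open_not_negligible[OF S(1,2)] by (simp add: negligible_iff_null_sets)
qed

lemma spherical_shell:
  fixes x0 :: "'a::euclidean_space"
  assumes "0 < r" "0 \<le> \<alpha>" "\<alpha> < \<beta>" "\<beta> \<le> 1"
  defines "S \<equiv> {x. ((x - x0) \<bullet> (x - x0)) / r\<^sup>2 \<in> {\<alpha><..<\<beta>}}"
  shows "open S" "S \<noteq> {}" "S \<subseteq> ball x0 r"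
proof -
  have "S = (\<lambda>x. ((x - x0) \<bullet> (x - x0)) / r\<^sup>2) -` {\<alpha><..<\<beta>}"
    by (auto simp: S_def)
  then show "open S"
    using \<open>0 < r\<close> by (auto intro!: open_vimage continuous_intros)
  obtain b :: 'a where b: "b \<in> Basis" using nonempty_Basis by blast
  \<comment> \<open>At this point the quotient is the midpoint of \<open>\<alpha>\<close> and
    \<open>\<beta>\<close>.\<close>
  have "x0 + (r * sqrt ((\<alpha> + \<beta>) / 2)) *\<^sub>R b \<in> S"
    using assms(1-4) b by (simp add: S_def power2_eq_square inner_Basis)
  then show "S \<noteq> {}" by blast
  show "S \<subseteq> ball x0 r"
  proof
    fix x assume "x \<in> S"
    then have "((x - x0) \<bullet> (x - x0)) / r\<^sup>2 < 1"
      using \<open>\<beta> \<le> 1\<close> by (auto simp: S_def)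
    then have "(norm (x - x0))\<^sup>2 < r\<^sup>2"
      using \<open>0 < r\<close> by (simp add: field_simps power2_norm_eq_inner)
    then show "x \<in> ball x0 r"
      using \<open>0 < r\<close> power2_less_imp_less[of "norm (x - x0)" r]
      by (simp add: dist_norm norm_minus_commute)
  qed
qed

section \<open>The oscillating H^1 function\<close>

text \<open>On the shell of radius about \<open>r\<close> the gradient of \<open>u\<close> is of order \<open>1/r\<close>, hence the
  energy of that shell is of order \<open>r\<close> to the power \<open>n - 2\<close>; for \<open>n > 2\<close> this is summable over
  the geometric sequence of radii.\<close>

lemma oscillating_H1_function:
  fixes \<Omega> :: "(real^'n::finite) set" and a :: real
  assumes n: "CARD('n) > 2" and \<Omega>: "open \<Omega>" "x0 \<in> \<Omega>"
  obtains u R where "u \<in> H1 \<Omega>" "0 < R" "ball x0 R \<subseteq> \<Omega>"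
    "\<And>k x. ((x - x0) \<bullet> (x - x0)) / (R / 2 ^ k)\<^sup>2 \<in> {5/8<..<7/8} \<Longrightarrow> u x = a"
    "\<And>k x. ((x - x0) \<bullet> (x - x0)) / (R / 2 ^ k)\<^sup>2 \<in> {1/4<..<1/2} \<Longrightarrow> u x = 0"
proof -
  obtain R0 where R0: "R0 > 0" "cball x0 R0 \<subseteq> \<Omega>"
    using \<Omega> open_contains_cball by blast
  \<comment> \<open>Radii of at most 1 make powers of \<open>r k\<close> decrease in the exponent,
    which is used for the volumes and for comparing \<open>1\<close>, \<open>1 / r k\<close> and
    their squares.\<close>
  define R where "R = min R0 1"
  have R: "0 < R" "R \<le> 1" "cball x0 R \<subseteq> \<Omega>"
    using R0 subset_cball[of R R0 x0] by (auto simp: R_def)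
  define r where "r k = R / 2 ^ k" for k :: nat
  have r: "0 < r k" "r k \<le> 1" "r k \<le> R" for k
  proof -
    show "0 < r k" using R by (simp add: r_def)
    have "R * 1 \<le> R * 2 ^ k" using R by (intro mult_left_mono) auto
    then show "r k \<le> R" by (simp add: r_def field_simps)
    with R show "r k \<le> 1" by simp
  qed
  have summ_r: "summable r"
    unfolding r_def[abs_def] using summable_mult[OF summable_geometric[of "1/2::real"], of R]
    by (simp add: power_one_over field_simps)
  obtain \<theta> \<theta>' C where \<theta>:
    "\<And>s. (\<theta> has_real_derivative \<theta>' s) (at s)"
    "continuous_on UNIV \<theta>'"
    "\<And>s. s \<notin> {1/2<..<1} \<Longrightarrow> \<theta> s = 0"
    "\<And>s. s \<notin> {1/2<..<1} \<Longrightarrow> \<theta>' s = 0"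
    "\<And>s. s \<in> {5/8..7/8} \<Longrightarrow> \<theta> s = 1"
    "\<And>s. \<bar>\<theta> s\<bar> \<le> C" "\<And>s. \<bar>\<theta>' s\<bar> \<le> C"
    by (rule C1_plateau_function) blast
  have C: "0 \<le> C" using \<theta>(6)[of 0] by linarith
  have cont_\<theta>: "continuous_on UNIV \<theta>"
    using \<theta>(1) by (meson DERIV_isCont continuous_at_imp_continuous_on)
  \<comment> \<open>The squared distance is a polynomial, so \<open>\<psi> k\<close> is C^1 even at
    the centre. Its support lies in the closure of the shell where \<open>Q k\<close> is in (1/2,
    1).\<close>
  define Q where "Q k x = ((x - x0) \<bullet> (x - x0)) / (r k)\<^sup>2" for k x
  define \<psi> where "\<psi> k x = a * \<theta> (Q k x)" for k x
  define \<psi>' where "\<psi>' i k x = a * (\<theta>' (Q k x) * (2 * (x - x0) $ i / (r k)\<^sup>2))" for i k x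
  have r_half: "4 * (r k)\<^sup>2 \<le> (r j)\<^sup>2" if "j < k" for j k
  proof -
    have "2 * r k \<le> r j"
    proof -
      have "(2::real) ^ Suc j \<le> 2 ^ k" using that by (intro power_increasing) auto
      then show ?thesis using R by (simp add: r_def field_simps)
    qed
    then have "(2 * r k)\<^sup>2 \<le> (r j)\<^sup>2"
      using r(1)[of k] by (intro power_mono) auto
    then show "4 * (r k)\<^sup>2 \<le> (r j)\<^sup>2" by (simp add: power_mult_distrib)
  qed
  \<comment> \<open>Within a shell the squared radius varies by a factor below 2, while from one
    shell to the next it drops by 4, so the shells are disjoint.\<close>
  have Q_unique: "j = k" if "Q j x \<in> {1/2<..<1}" "Q k x \<in> {1/2<..<1}" for j k x
  proof -
    have *: False if "j < k" "Q j x \<in> {1/2<..<1}" "Q k x \<in> {1/2<..<1}" for j k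
    proof -
      have "4 * (r k)\<^sup>2 \<le> (r j)\<^sup>2" by (rule r_half[OF that(1)])
      moreover have "(r j)\<^sup>2 < 2 * ((x - x0) \<bullet> (x - x0))" "(x - x0) \<bullet> (x - x0) < (r k)\<^sup>2"
        using that(2,3) r(1)[of j] r(1)[of k] by (auto simp: Q_def field_simps)
      moreover have "0 < (r k)\<^sup>2" using r(1)[of k] by simp
      ultimately show False by linarith
    qed
    then show ?thesis using that by (metis linorder_neqE_nat)
  qed
  have "\<exists>m. \<forall>k. k \<noteq> m \<longrightarrow> Q k x \<notin> {1/2<..<1}" for x
    using Q_unique by metis
  \<comment> \<open>\<open>m x\<close> is the index of the shell containing \<open>x\<close>, and
    arbitrary if there is none; then all terms vanish at \<open>x\<close>. Hence
    \<open>h (m x) x\<close> is always the pointwise sum of the series.\<close>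
  then obtain m where m: "\<And>k x. k \<noteq> m x \<Longrightarrow> Q k x \<notin> {1/2<..<1}" by metis
  have norm_le: "norm (x - x0) \<le> r k" if "Q k x \<in> {1/2<..<1}" for k x
    using that r(1)[of k] power2_le_imp_le[of "norm (x - x0)" "r k"]
    by (auto simp: Q_def field_simps power2_norm_eq_inner)
  have out: "Q k x \<notin> {1/2<..<1}" if "x \<notin> cball x0 (r k)" for k x
    using that norm_le[of k x] by (auto simp: dist_norm norm_minus_commute)

  define V where "V = measure lebesgue (ball (0::real^'n) 1)"
  have vol: "measure lebesgue (cball x0 (r k)) \<le> r k ^ 3 * V" for k
  proof -
    have "measure lebesgue (cball x0 (r k)) = r k ^ CARD('n) * V"
      using r(1)[of k] content_ball_conv_unit_ball[of "r k" x0]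
      by (simp add: content_cball_conv_ball V_def)
    \<comment> \<open>Here the dimension enters: it is at least 3 and \<open>r k\<close> is at most
      1.\<close>
    also have "\<dots> \<le> r k ^ 3 * V"
      using r(1)[of k] r(2)[of k] n by (intro mult_right_mono power_decreasing) (auto simp: V_def)
    finally show ?thesis .
  qed
  \<comment> \<open>The growth \<open>1 / (r k)\<^sup>2\<close> is that of a squared gradient.
    Against a volume of order \<open>r k ^ 3\<close> it leaves a multiple of \<open>r k\<close>, a
    geometric series.\<close>
  have series:
    "integrable (lebesgue_on \<Omega>) (\<lambda>x. h (m x) x)"
    "integrable (lebesgue_on \<Omega>) (h k)"
    "(\<lambda>k. LINT x|lebesgue_on \<Omega>. h k x) sums (LINT x|lebesgue_on \<Omega>. h (m x) x)"
    if cont: "\<And>k. continuous_on UNIV (h k)"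
      and zero: "\<And>k x. Q k x \<notin> {1/2<..<1} \<Longrightarrow> h k x = 0"
      and bound: "\<And>k x. Q k x \<in> {1/2<..<1} \<Longrightarrow> \<bar>h k x\<bar> \<le> K / (r k)\<^sup>2"
      and K: "0 \<le> K" for h K k
  proof -
    have summ: "summable (\<lambda>k. K / (r k)\<^sup>2 * measure lebesgue (cball x0 (r k)))"
    proof (rule summable_comparison_test'[OF summable_mult[OF summ_r, of "K * V"]])
      fix k
      have "K / (r k)\<^sup>2 * measure lebesgue (cball x0 (r k)) \<le> K / (r k)\<^sup>2 * (r k ^ 3 * V)"
        using K vol by (intro mult_left_mono) auto
      also have "\<dots> = K * V * r k"
        using r(1)[of k] by (simp add: field_simps power2_eq_square power3_eq_cube)
      finally show "norm (K / (r k)\<^sup>2 * measure lebesgue (cball x0 (r k))) \<le> K * V * r k"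
        using K by simp
    qed
    have sums: "(\<lambda>k. g (h k x)) sums g (h (m x) x)" if "g 0 = 0" for g :: "real \<Rightarrow> real" and x
      using sums_finite[of "{m x}" "\<lambda>k. g (h k x)"] zero m that by auto
    have bound': "\<bar>h k x\<bar> \<le> K / (r k)\<^sup>2" for k x
      using bound[of k x] zero[of k x] K by (cases "Q k x \<in> {1/2<..<1}") auto
    have supp: "h k x = 0" if "x \<notin> cball x0 (r k)" for k x
      using zero out[OF that] by blast
    have abs_summ: "summable (\<lambda>k. \<bar>h k x\<bar>)" for x
      using sums[of abs x] by (simp add: sums_iff)
    have H: "(\<lambda>k. h k x) sums h (m x) x" for x
      by (rule sums[of "\<lambda>y. y"]) simp
    note * = integral_sums_supported_cballs[OF \<Omega>(1) cont bound' supp summ abs_summ H]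
    show "integrable (lebesgue_on \<Omega>) (\<lambda>x. h (m x) x)" by (rule *(1))
    show "integrable (lebesgue_on \<Omega>) (h k)" by (rule *(2))
    show "(\<lambda>k. LINT x|lebesgue_on \<Omega>. h k x) sums (LINT x|lebesgue_on \<Omega>. h (m x) x)"
      by (rule *(3))
  qed
  have inv_r: "1 \<le> 1 / (r k)\<^sup>2" "1 / r k \<le> 1 / (r k)\<^sup>2" for k
    using r(1)[of k] r(2)[of k] 
    by (auto simp: field_simps power2_eq_square mult_le_one)

  have cont_Q: "continuous_on UNIV (Q k)" for k
    unfolding Q_def using r(1)[of k] by (intro continuous_intros) auto
  have cont_\<psi>: "continuous_on UNIV (\<psi> k)" for k
    unfolding \<psi>_def
    by (intro continuous_intros continuous_on_compose2[OF cont_\<theta> cont_Q]) auto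
  have cont_\<psi>': "continuous_on UNIV (\<psi>' i k)" for i k
    unfolding \<psi>'_def using r(1)[of k]
    by (intro continuous_intros continuous_on_compose2[OF \<theta>(2) cont_Q]) auto
  have zero_\<psi>: "\<psi> k x = 0" "\<psi>' i k x = 0" if "Q k x \<notin> {1/2<..<1}" for i k x
    using \<theta>(3,4)[OF that] by (auto simp: \<psi>_def \<psi>'_def)
  \<comment> \<open>One constant for both bounds; the 2 comes from differentiating the squared
    distance.\<close>
  define A where "A = 2 * \<bar>a\<bar> * C"
  have A: "0 \<le> A" using C by (simp add: A_def)
  have le_\<psi>: "\<bar>\<psi> k x\<bar> \<le> A" for k x
    using mult_mono[of "\<bar>a\<bar>" "2 * \<bar>a\<bar>" "\<bar>\<theta> (Q k x)\<bar>" C] \<theta>(6) by (simp add: \<psi>_def A_def abs_mult)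
  have le_\<psi>': "\<bar>\<psi>' i k x\<bar> \<le> A / r k" if "Q k x \<in> {1/2<..<1}" for i k x
  proof -
    have "\<bar>(x - x0) $ i\<bar> \<le> r k"
      using component_le_norm_cart[of "x - x0" i] norm_le[OF that] by linarith
    then have "\<bar>2 * (x - x0) $ i / (r k)\<^sup>2\<bar> \<le> 2 * r k / (r k)\<^sup>2"
      by (simp add: abs_mult divide_right_mono)
    also have "\<dots> = 2 / r k" by (simp add: power2_eq_square)
    finally have "\<bar>\<psi>' i k x\<bar> \<le> \<bar>a\<bar> * (C * (2 / r k))"
      using \<theta>(7) C unfolding \<psi>'_def abs_mult by (intro mult_left_mono mult_mono) auto
    then show ?thesis by (simp add: A_def mult_ac)
  qed
  have deriv_\<psi>: "((\<lambda>t. \<psi> k (x + t *\<^sub>R axis i 1)) has_real_derivative \<psi>' i k x) (at 0)" for i k x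
  proof -
    have "((\<lambda>t. Q k (x + t *\<^sub>R axis i 1)) has_real_derivative 2 * (x - x0) $ i / (r k)\<^sup>2) (at 0)"
    proof -
      have "Q k (x + t *\<^sub>R axis i 1) = ((x - x0) \<bullet> (x - x0) + 2 * t * (x - x0) $ i + t\<^sup>2) / (r k)\<^sup>2" for t
      proof -
        have "x + t *\<^sub>R axis i 1 - x0 = (x - x0) + t *\<^sub>R axis i 1" by simp
        then show ?thesis
          unfolding Q_def
          by (simp only: inner_add_left inner_add_right)
            (simp add: inner_axis inner_axis' power2_eq_square algebra_simps)
      qed
      moreover have "((\<lambda>t. (x - x0) \<bullet> (x - x0) + 2 * t * (x - x0) $ i + t\<^sup>2)
          has_real_derivative 2 * (x - x0) $ i) (at 0)"
        by (auto intro!: derivative_eq_intros)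
      ultimately show ?thesis
        by (simp only: DERIV_cdivide)
    qed
    from DERIV_cmult[OF DERIV_chain2[OF \<theta>(1) this], of a]
    show ?thesis by (simp add: \<psi>_def \<psi>'_def)
  qed

  define u where "u x = \<psi> (m x) x" for x
  define g where "g i x = \<psi>' i (m x) x" for i x
  \<comment> \<open>Integrability of the function itself supplies measurability; its square is
    bounded by \<open>A\<^sup>2 / (r k)\<^sup>2\<close>, exactly the growth allowed above.\<close>
  have L2: "L2_on \<Omega> (\<lambda>x. h (m x) x)"
    if h: "\<And>k. continuous_on UNIV (h k)" "\<And>k x. Q k x \<notin> {1/2<..<1} \<Longrightarrow> h k x = 0"
      "\<And>k x. Q k x \<in> {1/2<..<1} \<Longrightarrow> \<bar>h k x\<bar> \<le> A / r k" for h
  proof -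
    have "integrable (lebesgue_on \<Omega>) (\<lambda>x. h (m x) x)"
    proof (rule series(1)[OF h(1,2)])
      show "\<bar>h k x\<bar> \<le> A / (r k)\<^sup>2" if "Q k x \<in> {1/2<..<1}" for k x
        using h(3)[OF that] mult_left_mono[OF inv_r(2) A, of k] by simp
    qed (use A in auto)
    moreover have "integrable (lebesgue_on \<Omega>) (\<lambda>x. (h (m x) x)\<^sup>2)"
    proof (rule series(1)[where h = "\<lambda>k x. (h k x)\<^sup>2" and K = "A\<^sup>2"])
      show "\<bar>(h k x)\<^sup>2\<bar> \<le> A\<^sup>2 / (r k)\<^sup>2" if "Q k x \<in> {1/2<..<1}" for k x
        using power_mono[OF h(3)[OF that], of 2] by (simp add: power_divide)
    qed (use h in \<open>auto intro!: continuous_intros\<close>)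
    ultimately show ?thesis by (auto simp: L2_on_def)
  qed
  have "L2_on \<Omega> u"
    unfolding u_def
  proof (rule L2[OF cont_\<psi> zero_\<psi>(1)])
    fix k x
    have "A * 1 \<le> A * (1 / r k)"
      using r(1)[of k] r(2)[of k] A by (intro mult_left_mono) auto
    then show "\<bar>\<psi> k x\<bar> \<le> A / r k" using le_\<psi>[of k x] by simp
  qed
  moreover have "L2_on \<Omega> (g i)" for i
    unfolding g_def by (rule L2[OF cont_\<psi>' zero_\<psi>(2) le_\<psi>'])
  \<comment> \<open>Each \<open>\<psi> k\<close> is integrated by parts against
    \<open>\<phi>\<close>, and the resulting identities are summed over the shells.\<close>
  moreover have "(LINT x|lebesgue_on \<Omega>. u x * partial_deriv i \<phi> x) =
      - (LINT x|lebesgue_on \<Omega>. g i x * \<phi> x)" if "test_fun \<Omega> \<phi>" for i \<phi>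
  proof -
    define \<phi>' where "\<phi>' = partial_deriv i \<phi>"
    have sm: "smooth_fun \<phi>" using that by (simp add: test_fun_def)
    have cont_\<phi>: "continuous_on UNIV \<phi>" "continuous_on UNIV \<phi>'"
      using sm[unfolded smooth_fun_def, rule_format, THEN conjunct1, of "[]"]
        sm[unfolded smooth_fun_def, rule_format, THEN conjunct1, of "[i]"]
      by (simp_all add: iter_partial_def \<phi>'_def)
    have deriv_\<phi>: "((\<lambda>t. \<phi> (x + t *\<^sub>R axis i 1)) has_real_derivative \<phi>' x) (at 0)" for x
      using sm[unfolded smooth_fun_def, rule_format, THEN conjunct2, rule_format, of "[]" x i]
      by (simp add: iter_partial_def \<phi>'_def partial_deriv_def DERIV_deriv_iff_real_differentiable)
    \<comment> \<open>All shells lie in \<open>cball x0 R\<close>, so bounds on this ball are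
      enough.\<close>
    have "bounded (\<phi> ` cball x0 R \<union> \<phi>' ` cball x0 R)"
      using cont_\<phi> by (auto intro!: compact_imp_bounded compact_continuous_image
          intro: continuous_on_subset)
    then obtain N where "\<forall>y \<in> \<phi> ` cball x0 R \<union> \<phi>' ` cball x0 R. norm y \<le> N"
      unfolding bounded_iff by blast
    then have N: "\<bar>\<phi> x\<bar> \<le> N \<and> \<bar>\<phi>' x\<bar> \<le> N" if "x \<in> cball x0 R" for x
      using that unfolding real_norm_def by blast
    then have N0: "0 \<le> N" using R(1) abs_ge_zero[of "\<phi> x0"] by (meson centre_in_cball less_imp_le order_trans)
    have in_R: "x \<in> cball x0 R" if "Q k x \<in> {1/2<..<1}" for k x
      using norm_le[OF that] r(3)[of k] by (simp add: dist_norm norm_minus_commute)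
    have AN: "0 \<le> A * N" using A N0 by simp
    have bd1: "\<bar>\<psi> k x * \<phi>' x\<bar> \<le> A * N / (r k)\<^sup>2" if "Q k x \<in> {1/2<..<1}" for k x
    proof -
      have "\<bar>\<psi> k x * \<phi>' x\<bar> \<le> A * N"
        using N[OF in_R[OF that]] le_\<psi> A unfolding abs_mult by (intro mult_mono) auto
      also have "\<dots> \<le> A * N / (r k)\<^sup>2"
        using mult_left_mono[OF inv_r(1) AN, of k] by simp
      finally show ?thesis .
    qed
    have bd2: "\<bar>\<psi>' i k x * \<phi> x\<bar> \<le> A * N / (r k)\<^sup>2" if "Q k x \<in> {1/2<..<1}" for k x
    proof -
      have "\<bar>\<psi>' i k x * \<phi> x\<bar> \<le> A / r k * N"
        using N[OF in_R[OF that]] le_\<psi>'[OF that] A r(1)[of k] unfolding abs_mult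
        by (intro mult_mono) auto
      also have "\<dots> \<le> A * N / (r k)\<^sup>2"
        using mult_left_mono[OF inv_r(2) AN, of k] by simp
      finally show ?thesis .
    qed
    have cont1: "continuous_on UNIV (\<lambda>x. \<psi> k x * \<phi>' x)"
      and cont2: "continuous_on UNIV (\<lambda>x. \<psi>' i k x * \<phi> x)" for k
      by (intro continuous_intros cont_\<psi> cont_\<psi>' cont_\<phi>)+
    note s1 = series[where h = "\<lambda>k x. \<psi> k x * \<phi>' x", OF cont1 _ bd1 AN]
    note s2 = series[where h = "\<lambda>k x. \<psi>' i k x * \<phi> x", OF cont2 _ bd2 AN]
    have parts: "(LINT x|lebesgue_on \<Omega>. \<psi>' i k x * \<phi> x) = - (LINT x|lebesgue_on \<Omega>. \<psi> k x * \<phi>' x)" for k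
    proof -
      \<comment> \<open>By the product rule this is the i-th partial derivative of
        \<open>\<psi> k x * \<phi> x\<close>. It vanishes off a ball inside the domain, so its
        integral may be taken over the whole space, where it is 0.\<close>
      let ?D = "\<lambda>x. \<psi> k x * \<phi>' x + \<psi>' i k x * \<phi> x"
      have contD: "continuous_on UNIV ?D" by (intro continuous_on_add cont1 cont2)
      have zeroD: "?D x = 0" if "x \<notin> cball x0 R" for x
        using zero_\<psi>[of k x] in_R[of k x] that by (cases "Q k x \<in> {1/2<..<1}") auto
      have "(LINT x|lebesgue_on \<Omega>. \<psi> k x * \<phi>' x) + (LINT x|lebesgue_on \<Omega>. \<psi>' i k x * \<phi> x) =
          (LINT x|lebesgue_on \<Omega>. ?D x)"
        by (rule Bochner_Integration.integral_add[symmetric]) (auto intro!: s1(2) s2(2) simp: zero_\<psi>)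
      also have "\<dots> = (LINT x|lebesgue. indicator \<Omega> x *\<^sub>R ?D x)"
        using \<Omega>(1) by (intro integral_restrict_space) auto
      also have "\<dots> = (LINT x|lebesgue. ?D x)"
      proof (rule Bochner_Integration.integral_cong)
        show "indicator \<Omega> x *\<^sub>R ?D x = ?D x" for x
          using zeroD[OF contra_subsetD[OF R(3)], of x] by (cases "x \<in> \<Omega>") auto
      qed simp
      also have "\<dots> = (LINT x|lborel. ?D x)"
        using contD by (intro integral_completion) (auto intro: borel_measurable_continuous_onI)
      also have "\<dots> = 0"
      proof (rule integral_directional_derivative_eq_0[where w = "\<lambda>x. \<psi> k x * \<phi> x" and e = "axis i 1"])
        show "continuous_on UNIV (\<lambda>x. \<psi> k x * \<phi> x)"
          by (intro continuous_intros cont_\<psi> cont_\<phi>)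
        show "((\<lambda>t. \<psi> k (x + t *\<^sub>R axis i 1) * \<phi> (x + t *\<^sub>R axis i 1)) has_real_derivative ?D x) (at 0)" for x
          using DERIV_mult[OF deriv_\<psi>[of k x i] deriv_\<phi>[of x]] by (simp add: algebra_simps)
        show "\<bar>?D x\<bar> \<le> 2 * (A * N / (r k)\<^sup>2)" for x
        proof (cases "Q k x \<in> {1/2<..<1}")
          case True
          then show ?thesis using bd1[OF True] bd2[OF True] by linarith
        next
          case False
          then show ?thesis using zero_\<psi>[OF False] AN by simp
        qed
        show "\<psi> k x * \<phi> x = 0" if "x \<notin> cball x0 (r k)" for x
          using zero_\<psi>(1) out[OF that] by simp
      qed (rule contD)
      finally show ?thesis by linarith
    qed
    have "(\<lambda>k. - (LINT x|lebesgue_on \<Omega>. \<psi> k x * \<phi>' x)) sums (LINT x|lebesgue_on \<Omega>. g i x * \<phi> x)"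
      unfolding g_def parts[symmetric] by (rule s2(3)) (simp_all add: zero_\<psi>)
    moreover have "(\<lambda>k. - (LINT x|lebesgue_on \<Omega>. \<psi> k x * \<phi>' x)) sums - (LINT x|lebesgue_on \<Omega>. u x * \<phi>' x)"
      unfolding u_def by (intro sums_minus s1(3)) (simp_all add: zero_\<psi>)
    ultimately show ?thesis
      unfolding \<phi>'_def using sums_unique2 by fastforce
  qed
  ultimately have u_H1: "u \<in> H1 \<Omega>"
    unfolding H1_def by (intro CollectI conjI exI[of _ g]) blast+
  have u_a: "u x = a" if "Q k x \<in> {5/8<..<7/8}" for k x
  proof -
    have "k = m x" using m[of k x] that by fastforce
    then show ?thesis using that \<theta>(5)[of "Q k x"] by (simp add: u_def \<psi>_def)
  qed
  \<comment> \<open>In terms of \<open>Q k\<close>, the neighbouring supporting shells are (1/2, 1)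
    and (1/8, 1/4), so (1/4, 1/2) lies in the gap between them.\<close>
  have u_0: "u x = 0" if "Q k x \<in> {1/4<..<1/2}" for k x
  proof -
    have "Q j x \<notin> {1/2<..<1}" for j
    proof
      assume Qj: "Q j x \<in> {1/2<..<1}"
      have pos: "0 < (r j)\<^sup>2" "0 < (r k)\<^sup>2" using r(1)[of j] r(1)[of k] by simp_all
      have bounds: "(r j)\<^sup>2 < 2 * ((x - x0) \<bullet> (x - x0))" "(x - x0) \<bullet> (x - x0) < (r j)\<^sup>2"
        "(r k)\<^sup>2 < 4 * ((x - x0) \<bullet> (x - x0))" "2 * ((x - x0) \<bullet> (x - x0)) < (r k)\<^sup>2"
        using Qj that pos by (auto simp: Q_def field_simps)
      show False
      proof (cases "j \<le> k")
        case True
        then show ?thesis using r_half[of j k] bounds by (cases "j = k") auto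
      next
        case False
        then show ?thesis using r_half[of k j] bounds by auto
      qed
    qed
    then show ?thesis by (simp add: u_def zero_\<psi>)
  qed
  show ?thesis
  proof (rule that[OF u_H1 R(1)])
    show "ball x0 R \<subseteq> \<Omega>" using R(3) ball_subset_cball by blast
  qed (fact u_a[unfolded Q_def r_def] u_0[unfolded Q_def r_def])+
qed

section \<open>Comparing \<open>f a\<close> with \<open>f 0\<close>\<close>

theorem theorem2p1:
  fixes \<Omega> :: "(real^'n::finite) set" and f :: "real \<Rightarrow> real"
  assumes "CARD('n) > 2"
    and "open \<Omega>" and "connected \<Omega>" and "\<Omega> \<noteq> {}"
    and "\<forall>u \<in> H1 \<Omega>. has_C0_closure_rep \<Omega> (f \<circ> u)"
  shows "\<exists>c. \<forall>t. f t = c"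
proof -
  obtain x0 where x0: "x0 \<in> \<Omega>" using assms(4) by blast
  have "f a = f 0" for a
  proof -
    obtain u R where u: "u \<in> H1 \<Omega>" "0 < R" "ball x0 R \<subseteq> \<Omega>"
      and val: "\<And>k x. ((x - x0) \<bullet> (x - x0)) / (R / 2 ^ k)\<^sup>2 \<in> {5/8<..<7/8} \<Longrightarrow> u x = a"
        "\<And>k x. ((x - x0) \<bullet> (x - x0)) / (R / 2 ^ k)\<^sup>2 \<in> {1/4<..<1/2} \<Longrightarrow> u x = 0"
      using oscillating_H1_function[OF assms(1,2) x0] by blast
    obtain v where v: "continuous_on (closure \<Omega>) v" "AE x in lebesgue_on \<Omega>. (f \<circ> u) x = v x"
      using assms(5) u(1) unfolding has_C0_closure_rep_def by blast
    \<comment> \<open>Stated for a general family of shells, so that it applies both to those where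
      \<open>u\<close> is \<open>a\<close> and to those where \<open>u\<close> is 0.\<close>
    have "v x0 = f b"
      if b: "\<And>k x. ((x - x0) \<bullet> (x - x0)) / (R / 2 ^ k)\<^sup>2 \<in> {\<alpha><..<\<beta>} \<Longrightarrow> u x = b"
        and \<alpha>\<beta>: "0 \<le> \<alpha>" "\<alpha> < \<beta>" "\<beta> \<le> 1" for b \<alpha> \<beta>
    proof (rule continuous_value_at_accumulation[OF v(1) assms(2) x0 v(2)])
      fix d :: real assume "d > 0"
      obtain k where k: "R / 2 ^ k < d"
        using \<open>0 < R\<close> \<open>d > 0\<close> real_arch_pow_inv[of "d / R" "1/2"]
        by (auto simp: field_simps power_one_over)
      have rk: "0 < R / 2 ^ k" "R / 2 ^ k \<le> R"
        using \<open>0 < R\<close> by (auto simp: field_simps)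
      note S = spherical_shell[OF rk(1) \<alpha>\<beta>, of x0]
      show "\<exists>S. open S \<and> S \<noteq> {} \<and> S \<subseteq> \<Omega> \<inter> ball x0 d \<and> (\<forall>x\<in>S. (f \<circ> u) x = f b)"
        using S b u(3) k rk(2) subset_ball[of "R / 2 ^ k" d x0] subset_ball[OF rk(2), of x0]
        by (intro exI[of _ "{x. ((x - x0) \<bullet> (x - x0)) / (R / 2 ^ k)\<^sup>2 \<in> {\<alpha><..<\<beta>}}"] conjI)
          (auto 0 3)
    qed
    from this[of "5/8" "7/8" a, OF val(1)] this[of "1/4" "1/2" 0, OF val(2)]
    show "f a = f 0" by simp
  qed
  then show ?thesis by blast
qed

end
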